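(* Let $\mathcal{L}$ be a proper language generated by an unambiguous grammar, on an alphabet with $k$ letters, with rules of the form $$A\rightarrow w,\qquad A\rightarrow BC,\qquad A\rightarrow B\mathbin{\sqcup\!\sqcup} C,$$ where $w$ is a word and $A,B,C$ are non-terminals. Then the number $\ell(n)$ of words of length $n$ in $\mathcal{L}$ satisfies $\ell(n)=O\big((n!)^2\big)$ as $n\to\infty$.
   Context: A language is proper if it has finitely many words of each length. The rule $A\rightarrow BC$ denotes concatenation of languages. The rule $A\rightarrow B\mathbin{\sqcup\!\sqcup} C$ puts in the language of $A$ all words in $w_1\mathbin{\sqcup\!\sqcup} w_2$ with $w_1$ in the language of $B$ and $w_2$ in the language of $C$, where the shuffle of two words is defined recursively by $uw_1\mathbin{\sqcup\!\sqcup} vw_2=u(w_1\mathbin{\sqcup\!\sqcup} vw_2)+v(uw_1\mathbin{\sqcup\!\sqcup} w_2)$ for letters $u,v$ and words $w_1,w_2$, together with $w\mathbin{\sqcup\!\sqcup}\epsilon=w$ and $\epsilon\mathbin{\sqcup\!\sqcup} w=w$, with $\epsilon$ the empty word. Here $+$ is a disjoint union: letters coming from the second word that duplicate letters of the first are distinguished by a bar, e.g. $a\mathbin{\sqcup\!\sqcup} a=\{\overline{a}a,\,a\overline{a}\}$, so that the second operand of a shuffle is taken over a copy of its alphabet disjoint from that of the first operand (repeated shuffles may therefore use letters carrying several bars, and the alphabet in use can grow with the number of shuffle productions in a derivation). The alphabet with $k$ letters is the alphabet of the words $w$ in the grammar rules, before any bars are added; $k$ is fixed. *)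

theory Defs
  imports Complex_Main "HOL-Library.Landau_Symbols"
begin

text \<open>A letter of the alphabet together with the number of bars it carries.\<close>

type_synonym 'a letter = "'a \<times> nat"

definition unbarred :: "'a list \<Rightarrow> 'a letter list" where
  "unbarred w = map (\<lambda>a. (a, 0)) w"

text \<open>
  A barring convention \<open>\<beta>\<close> says which bars are added to the letters of the second word \<open>v\<close>
  when it is shuffled with \<open>u\<close>: \<open>\<beta> u v\<close> must turn the letters of \<open>v\<close> into a copy disjoint
  from the letters of \<open>u\<close>, by adding bars only.  How many bars are added, and whether letters
  of \<open>v\<close> that do not occur in \<open>u\<close> are barred as well, is left to the convention; everything below
  is relative to an arbitrary one, and \<open>least_barring\<close> is an example.
\<close>

type_synonym 'a barring = "'a letter list \<Rightarrow> 'a letter list \<Rightarrow> 'a letter \<Rightarrow> 'a letter"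

definition barring_convention :: "'a barring \<Rightarrow> bool" where
  "barring_convention \<beta> \<longleftrightarrow>
     (\<forall>u v. inj_on (\<beta> u v) (set v) \<and>
            \<beta> u v ` set v \<inter> set u = {} \<and>
            (\<forall>x\<in>set v. fst (\<beta> u v x) = fst x \<and> snd x \<le> snd (\<beta> u v x)))"

text \<open>
  The library function \<^const>\<open>shuffles\<close> satisfies the usual recursion for the shuffle of two
  words, without any distinction between letters of the two words.
\<close>

definition barred_shuffle :: "'a barring \<Rightarrow> 'a letter list \<Rightarrow> 'a letter list \<Rightarrow> 'a letter list set"
  where "barred_shuffle \<beta> u v = shuffles u (map (\<beta> u v) v)"

datatype ('n, 'a) rhs = Word "'a list" | Concat 'n 'n | Shuffle 'n 'n

record ('n, 'a) grammar =
  nonterminals :: "'n set"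
  alphabet :: "'a set"
  rules :: "('n \<times> ('n, 'a) rhs) set"
  start :: 'n

fun rhs_over :: "'n set \<Rightarrow> 'a set \<Rightarrow> ('n, 'a) rhs \<Rightarrow> bool" where
  "rhs_over N \<Sigma> (Word w) \<longleftrightarrow> w \<in> lists \<Sigma>"
| "rhs_over N \<Sigma> (Concat B C) \<longleftrightarrow> B \<in> N \<and> C \<in> N"
| "rhs_over N \<Sigma> (Shuffle B C) \<longleftrightarrow> B \<in> N \<and> C \<in> N"

definition shuffle_grammar :: "('n, 'a) grammar \<Rightarrow> bool" where
  "shuffle_grammar G \<longleftrightarrow>
     finite (nonterminals G) \<and> finite (alphabet G) \<and> finite (rules G) \<and>
     start G \<in> nonterminals G \<and>
     (\<forall>(A, r)\<in>rules G. A \<in> nonterminals G \<and> rhs_over (nonterminals G) (alphabet G) r)"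

text \<open>
  Derivation trees.  Every node carries the left-hand side of the rule applied there; the rest of
  the rule is read off from the children.  A shuffle node also records which word of
  the shuffle is chosen, so that a tree derives exactly one word.
\<close>

datatype ('n, 'a) derivation =
    WordNode 'n "'a list"
  | ConcatNode 'n "('n, 'a) derivation" "('n, 'a) derivation"
  | ShuffleNode 'n "'a letter list" "('n, 'a) derivation" "('n, 'a) derivation"

fun root :: "('n, 'a) derivation \<Rightarrow> 'n" where
  "root (WordNode A w) = A"
| "root (ConcatNode A s t) = A"
| "root (ShuffleNode A w s t) = A"

fun derived_word :: "('n, 'a) derivation \<Rightarrow> 'a letter list" where
  "derived_word (WordNode A w) = unbarred w"
| "derived_word (ConcatNode A s t) = derived_word s @ derived_word t"
| "derived_word (ShuffleNode A w s t) = w"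

fun valid_derivation :: "'a barring \<Rightarrow> ('n, 'a) grammar \<Rightarrow> ('n, 'a) derivation \<Rightarrow> bool" where
  "valid_derivation \<beta> G (WordNode A w) \<longleftrightarrow> (A, Word w) \<in> rules G"
| "valid_derivation \<beta> G (ConcatNode A s t) \<longleftrightarrow>
     (A, Concat (root s) (root t)) \<in> rules G \<and> valid_derivation \<beta> G s \<and> valid_derivation \<beta> G t"
| "valid_derivation \<beta> G (ShuffleNode A w s t) \<longleftrightarrow>
     (A, Shuffle (root s) (root t)) \<in> rules G \<and> valid_derivation \<beta> G s \<and> valid_derivation \<beta> G t \<and>
     w \<in> barred_shuffle \<beta> (derived_word s) (derived_word t)"

definition derives ::
  "'a barring \<Rightarrow> ('n, 'a) grammar \<Rightarrow> 'n \<Rightarrow> ('n, 'a) derivation \<Rightarrow> 'a letter list \<Rightarrow> bool" where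
  "derives \<beta> G A d w \<longleftrightarrow> valid_derivation \<beta> G d \<and> root d = A \<and> derived_word d = w"

definition nonterminal_language ::
  "'a barring \<Rightarrow> ('n, 'a) grammar \<Rightarrow> 'n \<Rightarrow> 'a letter list set" where
  "nonterminal_language \<beta> G A = {w. \<exists>d. derives \<beta> G A d w}"

definition language :: "'a barring \<Rightarrow> ('n, 'a) grammar \<Rightarrow> 'a letter list set" where
  "language \<beta> G = nonterminal_language \<beta> G (start G)"

definition unambiguous :: "'a barring \<Rightarrow> ('n, 'a) grammar \<Rightarrow> bool" where
  "unambiguous \<beta> G \<longleftrightarrow> (\<forall>w\<in>language \<beta> G. \<exists>!d. derives \<beta> G (start G) d w)"

definition words_of_length :: "'b list set \<Rightarrow> nat \<Rightarrow> 'b list set" where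
  "words_of_length L n = {w \<in> L. length w = n}"

definition proper :: "'b list set \<Rightarrow> bool" where
  "proper L \<longleftrightarrow> (\<forall>n. finite (words_of_length L n))"

lemma nonterminal_language_iff:
  "w \<in> nonterminal_language \<beta> G A \<longleftrightarrow>
     (\<exists>x. (A, Word x) \<in> rules G \<and> w = unbarred x) \<or>
     (\<exists>B C u v. (A, Concat B C) \<in> rules G \<and> u \<in> nonterminal_language \<beta> G B \<and>
        v \<in> nonterminal_language \<beta> G C \<and> w = u @ v) \<or>
     (\<exists>B C u v. (A, Shuffle B C) \<in> rules G \<and> u \<in> nonterminal_language \<beta> G B \<and>
        v \<in> nonterminal_language \<beta> G C \<and> w \<in> barred_shuffle \<beta> u v)"
    (is "?l \<longleftrightarrow> ?W \<or> ?C \<or> ?S")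
proof
  assume ?l
  then obtain d where "derives \<beta> G A d w" by (auto simp: nonterminal_language_def)
  then show "?W \<or> ?C \<or> ?S"
    by (cases d) (fastforce simp: nonterminal_language_def derives_def)+
next
  have "?W \<Longrightarrow> ?l"
    by (metis (mono_tags, lifting) derived_word.simps(1) derives_def mem_Collect_eq
        nonterminal_language_def root.simps(1) valid_derivation.simps(1))
  moreover have "?l" if ?C
  proof -
    from that obtain B C s t where "(A, Concat B C) \<in> rules G"
      "derives \<beta> G B s (derived_word s)" "derives \<beta> G C t (derived_word t)"
      "w = derived_word s @ derived_word t"
      by (auto simp: nonterminal_language_def derives_def)
    then have "derives \<beta> G A (ConcatNode A s t) w" by (auto simp: derives_def)
    then show ?l by (auto simp: nonterminal_language_def)
  qed
  moreover have "?l" if ?S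
  proof -
    from that obtain B C s t where "(A, Shuffle B C) \<in> rules G"
      "derives \<beta> G B s (derived_word s)" "derives \<beta> G C t (derived_word t)"
      "w \<in> barred_shuffle \<beta> (derived_word s) (derived_word t)"
      by (auto simp: nonterminal_language_def derives_def)
    then have "derives \<beta> G A (ShuffleNode A w s t) w" by (auto simp: derives_def)
    then show ?l by (auto simp: nonterminal_language_def)
  qed
  ultimately show "?W \<or> ?C \<or> ?S \<Longrightarrow> ?l" by blast
qed

text \<open>
  The convention that bars only letters whose base letter occurs in the first word, with as few
  bars as possible: the copies of \<open>a\<close> in \<open>v\<close> are shifted past all the copies of \<open>a\<close> in \<open>u\<close>.
\<close>

definition least_barring :: "'a barring" where
  "least_barring u v x = (fst x, snd x + (LEAST s. \<forall>y\<in>set u. fst y = fst x \<longrightarrow> snd y < s))"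

lemma barring_convention_least_barring: "barring_convention least_barring"
proof -
  have "least_barring u v x \<notin> set u" for u v :: "'a letter list" and x
  proof
    assume *: "least_barring u v x \<in> set u"
    let ?P = "\<lambda>s. \<forall>y\<in>set u. fst y = fst x \<longrightarrow> snd y < s"
    have "\<forall>y\<in>set u. snd y < Suc (Max (snd ` set u))"
      by (simp add: le_imp_less_Suc)
    then have "?P (LEAST s. ?P s)" by (intro LeastI[of ?P]) blast
    with * show False by (fastforce simp: least_barring_def)
  qed
  then show ?thesis
    by (auto simp: barring_convention_def inj_on_def) (auto simp: least_barring_def)
qed

lemma "barred_shuffle least_barring [(a, 0)] [(a, 0)] = {[(a, 0), (a, 1)], [(a, 1), (a, 0)]}"
proof -
  have "(LEAST s::nat. 0 < s) = 1" by (rule Least_equality) auto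
  then show ?thesis by (auto simp: barred_shuffle_def least_barring_def)
qed

end

theory Submission
  imports Defs
begin

text \<open>
  By properness and unambiguity the start symbol has only finitely many derivation trees of each
  yield length.  Hence no nonterminal can be pumped through siblings of empty yield, and the size
  of a tree is at most linear in the length \<open>n\<close> of its word.  The preorder sequence of the rules of
  a tree determines its shape, so there are at most \<open>c ^ n\<close> shapes up to a constant factor.  A fixed
  shape admits at most \<open>fact n\<close> choices of shuffles, as \<open>(i + j choose i) * fact i * fact j = fact (i + j)\<close>.
  In total this gives \<open>O(c ^ n * fact n)\<close>, which lies in \<open>O((fact n)\<^sup>2)\<close>.
\<close>

section \<open>Derivation trees, their rule sequences and their sizes\<close>

definition binary_rule :: "('n, 'a) grammar \<Rightarrow> 'n \<Rightarrow> 'n \<Rightarrow> 'n \<Rightarrow> bool" where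
  "binary_rule G A B C \<longleftrightarrow> (A, Concat B C) \<in> rules G \<or> (A, Shuffle B C) \<in> rules G"

text \<open>The word chosen at a shuffle node is deliberately dropped: what remains is the shape of
  the tree, and the choices are counted separately.\<close>

fun preorder :: "('n, 'a) derivation \<Rightarrow> ('n \<times> ('n, 'a) rhs) list" where
  "preorder (WordNode A w) = [(A, Word w)]"
| "preorder (ConcatNode A s t) = (A, Concat (root s) (root t)) # preorder s @ preorder t"
| "preorder (ShuffleNode A w s t) = (A, Shuffle (root s) (root t)) # preorder s @ preorder t"

abbreviation yield_length :: "('n, 'a) derivation \<Rightarrow> nat" where
  "yield_length d \<equiv> length (derived_word d)"

abbreviation nodes :: "('n, 'a) derivation \<Rightarrow> nat" where
  "nodes d \<equiv> length (preorder d)"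

definition trees :: "'a barring \<Rightarrow> ('n, 'a) grammar \<Rightarrow> 'n \<Rightarrow> ('n, 'a) derivation set" where
  "trees \<beta> G A = {d. valid_derivation \<beta> G d \<and> root d = A}"

lemma length_barred_shuffle:
  "w \<in> barred_shuffle \<beta> u v \<Longrightarrow> length w = length u + length v"
  by (auto simp: barred_shuffle_def dest: length_shuffles)

text \<open>Concatenation and shuffle both add lengths, so size arguments can treat the two kinds of
  inner node as one case.\<close>

lemma valid_derivation_induct [consumes 1, case_names word node]:
  assumes "valid_derivation \<beta> G d"
    and "\<And>A w. (A, Word w) \<in> rules G \<Longrightarrow> P (WordNode A w)"
    and "\<And>d s t. binary_rule G (root d) (root s) (root t) \<Longrightarrow>
           valid_derivation \<beta> G s \<Longrightarrow> valid_derivation \<beta> G t \<Longrightarrow>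
           yield_length d = yield_length s + yield_length t \<Longrightarrow>
           nodes d = Suc (nodes s + nodes t) \<Longrightarrow> P s \<Longrightarrow> P t \<Longrightarrow> P d"
  shows "P d"
  using assms(1)
proof (induction d)
  case (WordNode A w)
  then show ?case by (simp add: assms(2))
next
  case (ConcatNode A s t)
  show ?case
    by (rule assms(3)[of _ s t]) (use ConcatNode in \<open>auto simp: binary_rule_def\<close>)
next
  case (ShuffleNode A w s t)
  show ?case
    by (rule assms(3)[of _ s t])
      (use ShuffleNode in \<open>auto simp: binary_rule_def length_barred_shuffle\<close>)
qed

lemma trees_binary_rule:
  assumes "binary_rule G A B C" "s \<in> trees \<beta> G B" "t \<in> trees \<beta> G C"
  shows "\<exists>d\<in>trees \<beta> G A. yield_length d = yield_length s + yield_length t \<and>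
           nodes d = Suc (nodes s + nodes t)"
  using assms(1) unfolding binary_rule_def
proof
  assume "(A, Concat B C) \<in> rules G"
  then show ?thesis
    using assms(2,3) by (intro bexI[of _ "ConcatNode A s t"]) (auto simp: trees_def)
next
  assume "(A, Shuffle B C) \<in> rules G"
  \<comment> \<open>A shuffle of two words is never empty; the alternating one serves as
    witness.\<close>
  moreover let ?w = "splice (derived_word s) (map (\<beta> (derived_word s) (derived_word t)) (derived_word t))"
  have "?w \<in> barred_shuffle \<beta> (derived_word s) (derived_word t)"
    by (simp add: barred_shuffle_def)
  ultimately show ?thesis
    using assms(2,3) by (intro bexI[of _ "ShuffleNode A ?w s t"]) (auto simp: trees_def)
qed

section \<open>Embedding trees into trees of the start symbol\<close>

text \<open>The label \<open>m\<close> is the length gained when a tree of the child is extended to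
  a tree of the parent by adding the sibling.\<close>

definition child_step :: "'a barring \<Rightarrow> ('n, 'a) grammar \<Rightarrow> nat \<Rightarrow> ('n \<times> 'n) set" where
  "child_step \<beta> G m = {(A, B). \<exists>C. (binary_rule G A B C \<or> binary_rule G A C B) \<and>
                   (\<exists>t\<in>trees \<beta> G C. yield_length t = m)}"

lemma trees_step:
  assumes "(A, B) \<in> child_step \<beta> G m" "s \<in> trees \<beta> G B"
  shows "\<exists>d\<in>trees \<beta> G A. yield_length d = yield_length s + m \<and> nodes s < nodes d"
proof -
  obtain C t where t: "t \<in> trees \<beta> G C" "yield_length t = m"
    and rule: "binary_rule G A B C \<or> binary_rule G A C B"
    using assms(1) by (auto simp: child_step_def)
  from rule show ?thesis
  proof
    assume "binary_rule G A B C"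
    from trees_binary_rule[OF this assms(2) t(1)] t(2) show ?thesis by fastforce
  next
    assume "binary_rule G A C B"
    from trees_binary_rule[OF this t(1) assms(2)] t(2) show ?thesis
      by (fastforce simp: add.commute)
  qed
qed

text \<open>Every step on the path has a sibling that derives some word, so a tree of a reachable
  nonterminal can be completed to a tree of the start symbol.\<close>

definition reachable :: "'a barring \<Rightarrow> ('n, 'a) grammar \<Rightarrow> 'n set" where
  "reachable \<beta> G = (\<Union>m. child_step \<beta> G m)\<^sup>* `` {start G}"

text \<open>Fix one path from the start symbol and one sibling tree per step; \<open>m\<close> is
  the total yield length of these siblings. It is chosen before \<open>s\<close>, so trees of equal
  yield length are completed to trees of equal yield length.\<close>

lemma trees_reachable:
  assumes "A \<in> reachable \<beta> G"
  shows "\<exists>m. \<forall>s\<in>trees \<beta> G A. \<exists>d\<in>trees \<beta> G (start G).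
           yield_length d = yield_length s + m \<and> nodes s \<le> nodes d"
proof -
  have "(start G, A) \<in> (\<Union>m. child_step \<beta> G m)\<^sup>*"
    using assms by (simp add: reachable_def)
  then show ?thesis
  proof (induction rule: rtrancl_induct)
    case base
    show ?case by (intro exI[of _ 0]) auto
  next
    case (step A B)
    from step.IH obtain m where
      m: "\<And>s. s \<in> trees \<beta> G A \<Longrightarrow> \<exists>d\<in>trees \<beta> G (start G).
             yield_length d = yield_length s + m \<and> nodes s \<le> nodes d" by blast
    obtain l where l: "(A, B) \<in> child_step \<beta> G l" using step.hyps(2) by blast
    show ?case
    proof (intro exI[of _ "l + m"] ballI)
      fix s assume "s \<in> trees \<beta> G B"
      from trees_step[OF l this] obtain t where
        t: "t \<in> trees \<beta> G A" "yield_length t = yield_length s + l" "nodes s < nodes t" by blast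
      obtain d where "d \<in> trees \<beta> G (start G)" "yield_length d = yield_length t + m"
          "nodes t \<le> nodes d"
        using m[OF t(1)] by blast
      with t show "\<exists>d\<in>trees \<beta> G (start G).
          yield_length d = yield_length s + (l + m) \<and> nodes s \<le> nodes d"
        by (intro bexI[of _ d]) auto
    qed
  qed
qed

section \<open>Steps past a sibling of empty yield have no cycle\<close>

text \<open>The two side conditions make a cycle harmful: there is a tree to start pumping from, and
  the pumped trees extend to trees of the start symbol.\<close>

definition unit_step :: "'a barring \<Rightarrow> ('n, 'a) grammar \<Rightarrow> ('n \<times> 'n) set" where
  "unit_step \<beta> G = {(A, B) \<in> child_step \<beta> G 0. A \<in> reachable \<beta> G \<and> trees \<beta> G A \<noteq> {}}"

lemma trees_unit_step_trancl:
  assumes "(A, B) \<in> (unit_step \<beta> G)\<^sup>+" "s \<in> trees \<beta> G B"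
  shows "\<exists>d\<in>trees \<beta> G A. yield_length d = yield_length s \<and> nodes s < nodes d"
  using assms(1)
proof (induction rule: converse_trancl_induct)
  case (base A)
  then show ?case using trees_step[OF _ assms(2), of A 0] by (auto simp: unit_step_def)
next
  case (step A C)
  then obtain t where "t \<in> trees \<beta> G C" "yield_length t = yield_length s" "nodes s < nodes t"
    by blast
  with step.hyps(1) trees_step[of A C \<beta> G 0 t] show ?case
    by (fastforce simp: unit_step_def)
qed

text \<open>Unambiguity makes \<open>derived_word\<close> injective on these trees, and properness
  makes its image finite.\<close>

lemma finite_start_trees:
  assumes "unambiguous \<beta> G" "proper (language \<beta> G)"
  shows "finite {d \<in> trees \<beta> G (start G). yield_length d = n}" (is "finite ?T")
proof -
  have "inj_on derived_word ?T"
    using assms(1)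
    by (auto simp: inj_on_def unambiguous_def language_def nonterminal_language_def
        derives_def trees_def)
  moreover have "derived_word ` ?T \<subseteq> words_of_length (language \<beta> G) n"
    by (auto simp: words_of_length_def language_def nonterminal_language_def derives_def trees_def)
  ultimately show ?thesis
    using assms(2) by (meson finite_imageD finite_subset proper_def)
qed

text \<open>
  A cycle would wrap a tree in arbitrarily many extra nodes without changing the length of the
  derived word.  The word itself may change, since a shuffle with the empty word may add bars; hence
  unambiguity alone does not exclude the cycle, and properness is needed as well.
\<close>

lemma acyclic_unit_step:
  assumes "unambiguous \<beta> G" "proper (language \<beta> G)"
  shows "acyclic (unit_step \<beta> G)"
proof (rule acyclicI, rule allI, rule notI)
  fix A assume cycle: "(A, A) \<in> (unit_step \<beta> G)\<^sup>+"
  then obtain B where "(A, B) \<in> unit_step \<beta> G" by (meson tranclD)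
  then have A: "A \<in> reachable \<beta> G" "trees \<beta> G A \<noteq> {}" by (auto simp: unit_step_def)
  then obtain s where s: "s \<in> trees \<beta> G A" by blast
  have pumped: "\<exists>d\<in>trees \<beta> G A. yield_length d = yield_length s \<and> i \<le> nodes d" for i
  proof (induction i)
    case 0
    show ?case using s by auto
  next
    case (Suc i)
    then obtain t where "t \<in> trees \<beta> G A" "yield_length t = yield_length s" "i \<le> nodes t" by blast
    with trees_unit_step_trancl[OF cycle, of t] show ?case by fastforce
  qed
  obtain m where m: "\<And>t. t \<in> trees \<beta> G A \<Longrightarrow> \<exists>d\<in>trees \<beta> G (start G).
      yield_length d = yield_length t + m \<and> nodes t \<le> nodes d"
    using trees_reachable[OF A(1)] by blast
  \<comment> \<open>Since \<open>m\<close> does not depend on the pumped tree, all completed trees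
    lie in this one finite set, although their node counts are unbounded.\<close>
  let ?T = "{d \<in> trees \<beta> G (start G). yield_length d = yield_length s + m}"
  have "\<exists>d\<in>?T. i \<le> nodes d" for i
    using pumped[of i] m by fastforce
  moreover have "finite (nodes ` ?T)"
    using finite_start_trees[OF assms] by (rule finite_imageI)
  then have "\<exists>N. \<forall>d\<in>?T. nodes d < N"
    by (simp add: finite_nat_set_iff_bounded)
  ultimately show False by (meson leD)
qed

section \<open>Rank of a nonterminal and the linear bound on tree size\<close>

text \<open>A numerical height for a finite acyclic relation; it serves as a potential in the size
  bound.\<close>

definition rank :: "('n \<times> 'n) set \<Rightarrow> 'n \<Rightarrow> nat" where
  "rank r x = card (r\<^sup>+ `` {x})"

text \<open>All that lies below \<open>y\<close> lies below \<open>x\<close>; \<open>y\<close>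
  itself lies below \<open>x\<close> but, by acyclicity, not below itself.\<close>

lemma rank_less:
  assumes "finite r" "acyclic r" "(x, y) \<in> r"
  shows "rank r y < rank r x"
  unfolding rank_def
proof (rule psubset_card_mono)
  show "finite (r\<^sup>+ `` {x})" using assms(1) by (simp add: finite_Image)
  have "y \<in> r\<^sup>+ `` {x}" "y \<notin> r\<^sup>+ `` {y}" using assms(2,3) by (auto simp: acyclic_def)
  moreover have "r\<^sup>+ `` {y} \<subseteq> r\<^sup>+ `` {x}" using assms(3) by (auto intro: trancl_into_trancl2)
  ultimately show "r\<^sup>+ `` {y} \<subset> r\<^sup>+ `` {x}" by blast
qed

lemma rank_le_card_Range: "finite r \<Longrightarrow> rank r x \<le> card (Range r)"
  unfolding rank_def by (intro card_mono) (auto simp: finite_Range dest: tranclD2)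

lemma finite_unit_step:
  assumes "shuffle_grammar G"
  shows "finite (unit_step \<beta> G)"
proof (rule finite_subset)
  show "unit_step \<beta> G \<subseteq> nonterminals G \<times> nonterminals G"
    using assms
    by (fastforce simp: unit_step_def child_step_def binary_rule_def shuffle_grammar_def)
  show "finite (nonterminals G \<times> nonterminals G)"
    using assms by (simp add: shuffle_grammar_def)
qed

text \<open>A tree of either child is the sibling that the step to the other child requires.\<close>

lemma reachable_child:
  assumes "binary_rule G A B C" "trees \<beta> G B \<noteq> {}" "trees \<beta> G C \<noteq> {}" "A \<in> reachable \<beta> G"
  shows "B \<in> reachable \<beta> G" "C \<in> reachable \<beta> G"
proof -
  have "(A, B) \<in> (\<Union>m. child_step \<beta> G m)" "(A, C) \<in> (\<Union>m. child_step \<beta> G m)"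
    using assms(1-3) by (auto simp: child_step_def)
  then show "B \<in> reachable \<beta> G" "C \<in> reachable \<beta> G"
    using assms(4) by (auto simp: reachable_def intro: rtrancl_into_rtrancl)
qed

text \<open>Subtrees of empty yield have bounded size because ranks fall along every branch. Nodes
  with exactly one child of empty yield also lower the rank, so few of them follow each other; nodes
  with two children of nonempty yield are paid for by the yield length.\<close>

lemma nodes_linear_bound:
  fixes G :: "('n, 'a) grammar" and \<beta> :: "'a barring"
  assumes "shuffle_grammar G" "unambiguous \<beta> G" "proper (language \<beta> G)"
  shows "\<exists>M. \<forall>d\<in>trees \<beta> G (start G). nodes d \<le> M * Suc (yield_length d)"
proof -
  let ?r = "rank (unit_step \<beta> G)"
  define p where "p = card (Range (unit_step \<beta> G))"
  \<comment> \<open>A binary tree of height at most \<open>p\<close> has fewer than \<open>e\<close>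
    nodes.\<close>
  define e :: nat where "e = 2 ^ Suc p"
  \<comment> \<open>Exactly one new node plus two potentials \<open>e * p + e\<close>, the cost of
    joining two subtrees of nonempty yield.\<close>
  define k where "k = 1 + 2 * e * p + 2 * e"
  have fin: "finite (unit_step \<beta> G)" by (rule finite_unit_step) fact
  have le_p: "?r A \<le> p" for A unfolding p_def by (rule rank_le_card_Range) fact
  have less: "?r B < ?r A" if "(A, B) \<in> unit_step \<beta> G" for A B
    using rank_less[OF fin acyclic_unit_step[OF assms(2,3)] that] .
  have tr: "s \<in> trees \<beta> G (root s)" if "valid_derivation \<beta> G s" for s
    using that by (simp add: trees_def)
  have unit: "(yield_length t = 0 \<longrightarrow> ?r (root s) < ?r (root d)) \<and>
              (yield_length s = 0 \<longrightarrow> ?r (root t) < ?r (root d))"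
    if b: "binary_rule G (root d) (root s) (root t)" and "root d \<in> reachable \<beta> G"
      and st: "valid_derivation \<beta> G s" "valid_derivation \<beta> G t"
    for d s t :: "('n, 'a) derivation"
  proof -
    have "trees \<beta> G (root d) \<noteq> {}"
      using trees_binary_rule[OF b tr[OF st(1)] tr[OF st(2)]] by blast
    with that have "yield_length t = 0 \<Longrightarrow> (root d, root s) \<in> unit_step \<beta> G"
      and "yield_length s = 0 \<Longrightarrow> (root d, root t) \<in> unit_step \<beta> G"
      using tr by (fastforce simp: unit_step_def child_step_def)+
    then show ?thesis using less by blast
  qed
  \<comment> \<open>Both children again have empty yield, so both ranks drop and the rank bounds the
    height.\<close>
  have empty: "Suc (nodes d) \<le> 2 ^ Suc (?r (root d))"
    if "valid_derivation \<beta> G d" "root d \<in> reachable \<beta> G" "yield_length d = 0" for d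
    using that
  proof (induction rule: valid_derivation_induct)
    case (word A w)
    have "Suc (nodes (WordNode A w :: ('n, 'a) derivation)) = 2 * 1" by simp
    also have "\<dots> \<le> 2 * 2 ^ ?r A" by (intro mult_le_mono) simp_all
    finally show ?case by simp
  next
    case (node d s t)
    have "root s \<in> reachable \<beta> G" "root t \<in> reachable \<beta> G"
      using reachable_child[OF node.hyps(1) _ _ node.prems(1)] tr node.hyps(2,3) by blast+
    with node have "Suc (nodes s) \<le> 2 ^ Suc (?r (root s))" "Suc (nodes t) \<le> 2 ^ Suc (?r (root t))"
      by auto
    moreover have "?r (root s) < ?r (root d)" "?r (root t) < ?r (root d)"
      using unit[OF node.hyps(1) node.prems(1) node.hyps(2,3)] node.hyps(4) node.prems(2) by auto
    then have "(2::nat) ^ Suc (?r (root s)) \<le> 2 ^ ?r (root d)"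
      "(2::nat) ^ Suc (?r (root t)) \<le> 2 ^ ?r (root d)"
      by (intro power_increasing; simp)+
    ultimately show ?case using node.hyps(5) by simp
  qed
  have empty': "Suc (nodes d) \<le> e"
    if "valid_derivation \<beta> G d" "root d \<in> reachable \<beta> G" "yield_length d = 0" for d
  proof -
    have "(2::nat) ^ Suc (?r (root d)) \<le> e"
      unfolding e_def using le_p by (intro power_increasing) auto
    with empty[OF that] show ?thesis by simp
  qed
  \<comment> \<open>Amortised count: the term \<open>e * rank\<close> pays for siblings of empty
    yield, each costing at most \<open>e\<close> nodes including the parent. The surplus
    \<open>k\<close> on the left pays for branching.\<close>
  have nonempty: "nodes d + k \<le> 2 * k * yield_length d + e * ?r (root d) + e"
    if "valid_derivation \<beta> G d" "root d \<in> reachable \<beta> G" "yield_length d > 0" for d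
    using that
  proof (induction rule: valid_derivation_induct)
    case (word A w)
    then have "2 * k * 1 \<le> 2 * k * length w" by (intro mult_le_mono) (auto simp: unbarred_def Suc_le_eq)
    moreover have "1 \<le> k" by (simp add: k_def)
    ultimately have "Suc k \<le> 2 * k * length w" by linarith
    then show ?case by (simp add: unbarred_def)
  next
    case (node d s t)
    have r: "root s \<in> reachable \<beta> G" "root t \<in> reachable \<beta> G"
      using reachable_child[OF node.hyps(1) _ _ node.prems(1)] tr node.hyps(2,3) by blast+
    note u = unit[OF node.hyps(1) node.prems(1) node.hyps(2,3)]
    have rank_step: "e * i + e \<le> e * j" if "i < j" for i j :: nat
      using mult_le_mono2[OF Suc_leI[OF that], of e] by simp
    consider "yield_length s = 0" "yield_length t > 0" | "yield_length t = 0" "yield_length s > 0"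
      | "yield_length s > 0" "yield_length t > 0"
      using node.hyps(4) node.prems(2) by linarith
    then show ?case
    proof cases
      case 1
      with u have "e * ?r (root t) + e \<le> e * ?r (root d)" by (intro rank_step) auto
      with node.IH(2)[OF r(2) 1(2)] empty'[OF node.hyps(2) r(1) 1(1)] 1 node.hyps(4,5)
      show ?thesis by simp
    next
      case 2
      with u have "e * ?r (root s) + e \<le> e * ?r (root d)" by (intro rank_step) auto
      with node.IH(1)[OF r(1) 2(2)] empty'[OF node.hyps(3) r(2) 2(1)] 2 node.hyps(4,5)
      show ?thesis by simp
    next
      case 3
      \<comment> \<open>The two induction hypotheses supply \<open>2 * k\<close> on the left and
        only \<open>k\<close> must remain; the other \<open>k\<close> covers the new node and both
        potentials.\<close>
      have "e * ?r (root s) \<le> e * p" "e * ?r (root t) \<le> e * p" using le_p by auto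
      moreover have "k = 1 + 2 * (e * p) + 2 * e" by (simp add: k_def)
      moreover have "2 * k * yield_length d = 2 * k * yield_length s + 2 * k * yield_length t"
        using node.hyps(4) by (simp add: add_mult_distrib2)
      ultimately show ?thesis
        using node.IH(1)[OF r(1) 3(1)] node.IH(2)[OF r(2) 3(2)] node.hyps(5) by linarith
    qed
  qed
  have "nodes d \<le> 2 * k * Suc (yield_length d)" if "d \<in> trees \<beta> G (start G)" for d
  proof -
    have d: "valid_derivation \<beta> G d" "root d \<in> reachable \<beta> G"
      using that by (auto simp: trees_def reachable_def)
    have k: "e * p + e \<le> k" by (simp add: k_def)
    \<comment> \<open>The \<open>Suc\<close> in the bound accommodates trees of the empty word,
      which \<open>nonempty\<close> leaves out.\<close>
    show ?thesis
    proof (cases "yield_length d = 0")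
      case True
      with empty'[OF d] k show ?thesis by simp
    next
      case False
      have "e * ?r (root d) \<le> e * p" using le_p by (intro mult_le_mono2)
      with nonempty[OF d] False k have "nodes d \<le> 2 * k * yield_length d" by linarith
      then show ?thesis by simp
    qed
  qed
  then show ?thesis by blast
qed

section \<open>Counting the trees of a fixed shape\<close>

text \<open>As in Polish notation, each rule tells how many subtrees follow, so the sequence itself
  shows where a tree ends. The trees may still differ in the words chosen at shuffle nodes.\<close>

lemma preorder_prefix_free:
  "preorder s @ xs = preorder t @ ys \<Longrightarrow> preorder s = preorder t \<and> xs = ys"
proof (induction s arbitrary: t xs ys)
  case (WordNode A w)
  then show ?case by (cases t) auto
next
  case (ConcatNode A s1 s2)
  from ConcatNode.prems obtain t1 t2 where t: "t = ConcatNode A t1 t2"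
    "preorder s1 @ preorder s2 @ xs = preorder t1 @ preorder t2 @ ys"
    "root s1 = root t1" "root s2 = root t2"
    by (cases t) auto
  have "preorder s1 = preorder t1" and tail: "preorder s2 @ xs = preorder t2 @ ys"
    using ConcatNode.IH(1)[OF t(2)] by auto
  with ConcatNode.IH(2)[OF tail] t show ?case by simp
next
  case (ShuffleNode A w s1 s2)
  from ShuffleNode.prems obtain v t1 t2 where t: "t = ShuffleNode A v t1 t2"
    "preorder s1 @ preorder s2 @ xs = preorder t1 @ preorder t2 @ ys"
    "root s1 = root t1" "root s2 = root t2"
    by (cases t) auto
  have "preorder s1 = preorder t1" and tail: "preorder s2 @ xs = preorder t2 @ ys"
    using ShuffleNode.IH(1)[OF t(2)] by auto
  with ShuffleNode.IH(2)[OF tail] t show ?case by simp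
qed

definition same_shape ::
  "'a barring \<Rightarrow> ('n, 'a) grammar \<Rightarrow> ('n, 'a) derivation \<Rightarrow> ('n, 'a) derivation set" where
  "same_shape \<beta> G d = {d'. valid_derivation \<beta> G d' \<and> preorder d' = preorder d}"

lemma same_shape_ConcatNode:
  "same_shape \<beta> G (ConcatNode A s t) \<subseteq>
     (\<lambda>(s', t'). ConcatNode A s' t') ` (same_shape \<beta> G s \<times> same_shape \<beta> G t)"
proof
  fix d assume d: "d \<in> same_shape \<beta> G (ConcatNode A s t)"
  then obtain s' t' where "d = ConcatNode A s' t'" "preorder s' @ preorder t' = preorder s @ preorder t"
    by (cases d) (auto simp: same_shape_def)
  with d preorder_prefix_free[of s' "preorder t'" s "preorder t"]
  show "d \<in> (\<lambda>(s', t'). ConcatNode A s' t') ` (same_shape \<beta> G s \<times> same_shape \<beta> G t)"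
    by (auto simp: same_shape_def)
qed

text \<open>A dependent sum is used because the bars, and with them the available shuffles, depend
  on the words derived by the chosen subtrees.\<close>

lemma same_shape_ShuffleNode:
  "same_shape \<beta> G (ShuffleNode A w s t) \<subseteq>
     (\<lambda>((s', t'), w'). ShuffleNode A w' s' t') `
       (SIGMA (s', t') : same_shape \<beta> G s \<times> same_shape \<beta> G t.
          barred_shuffle \<beta> (derived_word s') (derived_word t'))" (is "_ \<subseteq> ?R")
proof
  fix d assume d: "d \<in> same_shape \<beta> G (ShuffleNode A w s t)"
  then obtain s' t' w' where d': "d = ShuffleNode A w' s' t'"
    "preorder s' @ preorder t' = preorder s @ preorder t"
    by (cases d) (auto simp: same_shape_def)
  with d preorder_prefix_free[of s' "preorder t'" s "preorder t"]
  show "d \<in> ?R"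
    by (auto simp: same_shape_def intro!: image_eqI[of _ _ "((s', t'), w')"])
qed

fun rhs_length :: "('n, 'a) rhs \<Rightarrow> nat" where
  "rhs_length (Word w) = length w"
| "rhs_length (Concat B C) = 0"
| "rhs_length (Shuffle B C) = 0"

text \<open>Only word rules contribute letters, so the shape of a tree fixes its yield
  length.\<close>

lemma yield_length_preorder:
  "valid_derivation \<beta> G d \<Longrightarrow> yield_length d = (\<Sum>(A, r)\<leftarrow>preorder d. rhs_length r)"
  by (induction d) (auto simp: unbarred_def length_barred_shuffle)

lemma yield_length_same_shape:
  "valid_derivation \<beta> G d \<Longrightarrow> d' \<in> same_shape \<beta> G d \<Longrightarrow> yield_length d' = yield_length d"
  by (metis (mono_tags, lifting) mem_Collect_eq same_shape_def yield_length_preorder)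

lemma finite_barred_shuffle: "finite (barred_shuffle \<beta> u v)"
  by (simp add: barred_shuffle_def)

text \<open>The bars make the letters of the two words disjoint, so distinct interleavings give
  distinct words.\<close>

lemma card_barred_shuffle:
  assumes "barring_convention \<beta>"
  shows "card (barred_shuffle \<beta> u v) = (length u + length v) choose length u"
proof -
  have "set u \<inter> set (map (\<beta> u v) v) = {}"
    using assms by (auto simp: barring_convention_def)
  from card_disjoint_shuffles[OF this] show ?thesis by (simp add: barred_shuffle_def)
qed

text \<open>The bound is preserved at inner nodes: a product of factorials is at most the factorial
  of the sum, and at a shuffle the binomial coefficient makes up precisely the missing
  factor.\<close>

lemma card_same_shape_le_fact:
  assumes "barring_convention \<beta>" "valid_derivation \<beta> G d"
  shows "finite (same_shape \<beta> G d) \<and> card (same_shape \<beta> G d) \<le> fact (yield_length d)"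
  using assms(2)
proof (induction d)
  case (WordNode A w)
  have "d \<in> same_shape \<beta> G (WordNode A w) \<Longrightarrow> d = WordNode A w" for d
    by (cases d) (auto simp: same_shape_def)
  then have sub: "same_shape \<beta> G (WordNode A w) \<subseteq> {WordNode A w}" by blast
  have "card (same_shape \<beta> G (WordNode A w)) \<le> 1"
    using card_mono[OF _ sub] by simp
  also have "\<dots> \<le> fact (yield_length (WordNode A w :: ('b, 'a) derivation))" by (rule fact_ge_1)
  finally show ?case using finite_subset[OF sub] by simp
next
  case (ConcatNode A s t)
  let ?X = "same_shape \<beta> G s" and ?Y = "same_shape \<beta> G t"
  have IH: "finite ?X" "finite ?Y" "card ?X \<le> fact (yield_length s)" "card ?Y \<le> fact (yield_length t)"
    using ConcatNode by auto
  have "card (same_shape \<beta> G (ConcatNode A s t)) \<le> card (?X \<times> ?Y)"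
    using IH by (intro surj_card_le[OF _ same_shape_ConcatNode]) auto
  also have "\<dots> \<le> fact (yield_length s) * fact (yield_length t)"
    using IH by (simp add: card_cartesian_product mult_le_mono)
  also have "\<dots> \<le> fact (yield_length s + yield_length t)"
    by (intro dvd_imp_le fact_fact_dvd_fact) simp
  finally show ?case
    using finite_subset[OF same_shape_ConcatNode finite_imageI[OF finite_cartesian_product]] IH
    by simp
next
  case (ShuffleNode A w s t)
  let ?X = "same_shape \<beta> G s" and ?Y = "same_shape \<beta> G t"
  let ?i = "yield_length s" and ?j = "yield_length t"
  have valid: "valid_derivation \<beta> G s" "valid_derivation \<beta> G t" "length w = ?i + ?j"
    using ShuffleNode.prems by (auto simp: length_barred_shuffle)
  have IH: "finite ?X" "finite ?Y" "card ?X \<le> fact ?i" "card ?Y \<le> fact ?j"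
    using ShuffleNode by auto
  let ?S = "SIGMA (s', t') : ?X \<times> ?Y. barred_shuffle \<beta> (derived_word s') (derived_word t')"
  have fin: "finite ?S" using IH by (auto intro!: finite_SigmaI finite_barred_shuffle)
  have "card (same_shape \<beta> G (ShuffleNode A w s t)) \<le> card ?S"
    by (rule surj_card_le[OF fin same_shape_ShuffleNode])
  also have "card ?S = (\<Sum>(s', t') \<in> ?X \<times> ?Y. card (barred_shuffle \<beta> (derived_word s') (derived_word t')))"
    using IH by (subst card_SigmaI) (auto simp: finite_barred_shuffle split_def)
  \<comment> \<open>The shuffle sets vary with the subtrees, but equal shapes give equal yield
    lengths, so all have the same binomial size.\<close>
  also have "\<dots> = (\<Sum>(s', t') \<in> ?X \<times> ?Y. ?i + ?j choose ?i)"
    using valid by (intro sum.cong)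
      (auto simp: card_barred_shuffle[OF assms(1)] yield_length_same_shape)
  also have "\<dots> = card ?X * card ?Y * (?i + ?j choose ?i)"
    by (simp add: split_def card_cartesian_product)
  also have "\<dots> \<le> fact ?i * fact ?j * (?i + ?j choose ?i)"
    using IH by (intro mult_le_mono) auto
  also have "\<dots> = fact (?i + ?j)"
    using binomial_fact_lemma[of ?i "?i + ?j"] by simp
  finally show ?case
    using finite_subset[OF same_shape_ShuffleNode finite_imageI[OF fin]] valid(3) by simp
qed

lemma set_preorder: "valid_derivation \<beta> G d \<Longrightarrow> set (preorder d) \<subseteq> rules G"
  by (induction d) auto

section \<open>Counting rule sequences and the asymptotic bound\<close>

text \<open>Bounds the number of lists of length at most \<open>n\<close> by a single power; the
  extra symbol can be read as padding to length \<open>n\<close>.\<close>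

lemma sum_powers_le: "(\<Sum>i\<le>n. (a::nat) ^ i) \<le> Suc a ^ n"
proof (induction n)
  case (Suc n)
  have "a ^ n \<le> Suc a ^ n" by (intro power_mono) auto
  then have "a * a ^ n \<le> a * Suc a ^ n" by (rule mult_le_mono2)
  with Suc have "(\<Sum>i\<le>n. a ^ i) + a * a ^ n \<le> Suc a ^ n + a * Suc a ^ n" by (rule add_mono)
  then show ?case by simp
qed simp

text \<open>The quotients are the terms of the exponential series and so tend to zero.\<close>

lemma power_in_bigo_fact: "(\<lambda>n. c ^ n) \<in> O(\<lambda>n. fact n :: real)"
proof -
  have "(\<lambda>n. inverse (fact n) * c ^ n) \<longlonglongrightarrow> 0"
    using summable_LIMSEQ_zero[OF summable_exp] .
  then have "(\<lambda>n. c ^ n / fact n) \<longlonglongrightarrow> 0" by (simp add: field_simps)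
  then show ?thesis
    by (intro landau_o.small_imp_big smalloI_tendsto) auto
qed

theorem theorem3p2:
  fixes G :: "('n, 'a) grammar" and \<beta> :: "'a barring" and k :: nat
  assumes "barring_convention \<beta>"
    and "shuffle_grammar G"
    and "card (alphabet G) = k"
    and "unambiguous \<beta> G"
    and "proper (language \<beta> G)"
  shows "(\<lambda>n. real (card (words_of_length (language \<beta> G) n))) \<in> O(\<lambda>n. (fact n)\<^sup>2)"
proof -
  obtain M where M: "\<And>d. d \<in> trees \<beta> G (start G) \<Longrightarrow> nodes d \<le> M * Suc (yield_length d)"
    using nodes_linear_bound[OF assms(2,4,5)] by blast
  \<comment> \<open>Chosen so that the number of rule sequences of length at most
    \<open>M * Suc n\<close> is at most \<open>c ^ Suc n\<close>, written \<open>c * c ^ n\<close>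
    below.\<close>
  define c where "c = Suc (card (rules G)) ^ M"
  have bound: "card (words_of_length (language \<beta> G) n) \<le> c * c ^ n * fact n" for n
  proof -
    let ?T = "{d \<in> trees \<beta> G (start G). yield_length d = n}"
    let ?P = "{xs. set xs \<subseteq> rules G \<and> length xs \<le> M * Suc n}"
    \<comment> \<open>The trees are grouped by rule sequence; each group lies in a single shape
      class.\<close>
    let ?F = "\<lambda>xs. {d \<in> ?T. preorder d = xs}"
    have fin: "finite (rules G)" using assms(2) by (simp add: shuffle_grammar_def)
    have finT: "finite ?T" by (rule finite_start_trees) fact+
    have fibre: "card (?F xs) \<le> fact n" for xs
    proof (cases "?F xs = {}")
      case True
      then show ?thesis by (metis card.empty le0)
    next
      case False
      then obtain d where d: "d \<in> ?F xs" by blast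
      then have "?F xs \<subseteq> same_shape \<beta> G d" by (auto simp: trees_def same_shape_def)
      moreover have "finite (same_shape \<beta> G d) \<and> card (same_shape \<beta> G d) \<le> fact n"
        using card_same_shape_le_fact[OF assms(1), of G d] d by (auto simp: trees_def)
      ultimately show ?thesis by (meson card_mono le_trans)
    qed
    have "words_of_length (language \<beta> G) n \<subseteq> derived_word ` ?T"
      by (auto simp: words_of_length_def language_def nonterminal_language_def derives_def trees_def)
    then have "card (words_of_length (language \<beta> G) n) \<le> card ?T"
      by (rule surj_card_le[OF finT])
    also have "?T \<subseteq> (\<Union>xs\<in>?P. ?F xs)"
      using M set_preorder by (fastforce simp: trees_def)
    then have "card ?T \<le> card (\<Union>xs\<in>?P. ?F xs)"
      by (intro card_mono finite_subset[OF _ finT]) blast+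
    also have "\<dots> \<le> (\<Sum>xs\<in>?P. card (?F xs))"
      by (rule card_UN_le) (simp add: finite_lists_length_le fin)
    also have "\<dots> \<le> card ?P * fact n"
      using sum_bounded_above[of ?P "\<lambda>xs. card (?F xs)" "fact n"] fibre by simp
    also have "card ?P \<le> Suc (card (rules G)) ^ (M * Suc n)"
      using sum_powers_le by (simp add: card_lists_length_le fin)
    also have "\<dots> = c * c ^ n" by (simp add: c_def power_mult power_add)
    finally show ?thesis by simp
  qed
  have "(\<lambda>n. real (card (words_of_length (language \<beta> G) n))) \<in> O(\<lambda>n. real c ^ n * fact n)"
  proof (intro bigoI[of _ "real c"] always_eventually allI)
    fix n
    have "real (card (words_of_length (language \<beta> G) n)) \<le> real (c * c ^ n * fact n)"
      using bound by (rule of_nat_mono)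
    then show "norm (real (card (words_of_length (language \<beta> G) n)))
        \<le> real c * norm (real c ^ n * fact n)" by simp
  qed
  \<comment> \<open>One factorial counts the shuffle choices, the other absorbs the exponential
    number of shapes.\<close>
  also have "(\<lambda>n. real c ^ n * fact n) \<in> O(\<lambda>n. fact n * fact n)"
    by (intro landau_o.big.mult power_in_bigo_fact) simp
  finally show ?thesis by (simp add: power2_eq_square)
qed

end
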